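(* There is an absolute constant $C>0$ such that the following holds. Let $A\in\mathbb{R}^{n\times n}$ be a balanceable matrix and let $\epsilon>0$. Let $(\pi_k)_{k\ge0}$ be an arbitrary sequence of permutations of $[n]$, and let $u_0=\mathbf 0,u_1,u_2,\dots$ be the vectors obtained after $0,1,2,\dots$ cycles of cyclic Osborne with update orderings $(\pi_k)_{k\ge 0}$ run on $A$. Then there is an integer $t$ with $0\le t\le C\,\frac{\log\kappa}{\epsilon}\min\{\frac1\epsilon,d\}$ such that $\mathbb{D}(e^{u_t})$ $\epsilon$-balances $A$. That is, cyclic Osborne with arbitrary (and potentially changing) orderings of updates across cycles finds an $\epsilon$-balancing after $K=O\big(\frac{\log\kappa}{\epsilon}\min\{\frac1\epsilon,d\}\big)$ cycles. This amounts to $O\big(\frac{m\log\kappa}{\epsilon}\min\{\frac1\epsilon,d\}\big)$ arithmetic operations.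
   Context: Throughout $n\ge 2$ and $A\in\mathbb{R}^{n\times n}$ has nonnegative entries and zero diagonal. $G_A$ is the directed graph on $[n]=\{1,\dots,n\}$ with edge set $\{(i,j):A_{ij}\ne0\}$. $A$ is called balanceable if $G_A$ is strongly connected. Parameters: $m$ is the number of nonzero entries of $A$; $\kappa=\big(\sum_{i,j}A_{ij}\big)/\min_{(i,j):A_{ij}\ne0}A_{ij}$; $d$ is the diameter of $G_A$ (the maximum over ordered pairs $(i,j)$ of the length of a shortest directed path from $i$ to $j$). For $u\in\mathbb{R}^n$ with coordinates $u^{(1)},\dots,u^{(n)}$, $\mathbb{D}(e^{u})$ is the diagonal matrix with diagonal entries $e^{u^{(1)}},\dots,e^{u^{(n)}}$. Let $M(u)=\mathbb{D}(e^u)A\,\mathbb{D}(e^{-u})$, so $M(u)_{ij}=e^{u^{(i)}-u^{(j)}}A_{ij}$; let $r_j(u)=\sum_i M(u)_{ji}$ and $c_j(u)=\sum_i M(u)_{ij}$. $\mathbb{D}(e^u)$ $\epsilon$-balances $A$ if $\sum_{j=1}^n|r_j(u)-c_j(u)|\le\epsilon\sum_{i,j}M(u)_{ij}$. Cyclic Osborne with update orderings $(\pi_k)$: set $u_0=\mathbf 0$. In cycle $k=0,1,2,\dots$, start from $u=u_k$ and, for $j=\pi_k(1),\pi_k(2),\dots,\pi_k(n)$ in this order, replace the $j$-th coordinate of the current vector $u$ by $u^{(j)}+\tfrac12\log c_j(u)-\tfrac12\log r_j(u)$, leaving the other coordinates unchanged; the vector at the end of the cycle is $u_{k+1}$. Arithmetic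 operations are counted in the exact real-number model (arithmetic operations and elementary functions $\sqrt{\cdot},\exp,\log$ at unit cost), with $A$ accessed through its nonzero entries. *)

theory Defs
  imports
    Complex_Main
    "HOL-Combinatorics.Permutations"
    "Jordan_Normal_Form.Matrix"
    "Graph_Theory.Digraph_Component"
    "Graph_Theory.Pair_Digraph"
begin

text \<open>
  Index sets are zero-based: \<open>[n]\<close> is rendered as \<open>{..<n}\<close>. Matrices and vectors carry
  their dimension as a value, so that constants can be quantified before the dimension.
\<close>

definition support :: "real mat \<Rightarrow> (nat \<times> nat) set" where
  "support A = {(i, j). i < dim_row A \<and> j < dim_col A \<and> A $$ (i, j) \<noteq> 0}"

definition mat_graph :: "real mat \<Rightarrow> nat pair_pre_digraph" where
  "mat_graph A = \<lparr> pverts = {..<dim_row A}, parcs = support A \<rparr>"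

definition balanceable :: "real mat \<Rightarrow> bool" where
  "balanceable A \<longleftrightarrow> strongly_connected (with_proj (mat_graph A))"

definition path_dist :: "('a, 'b) pre_digraph \<Rightarrow> 'a \<Rightarrow> 'a \<Rightarrow> nat" where
  "path_dist G u v = (LEAST k. \<exists>p. pre_digraph.apath G u p v \<and> length p = k)"

text \<open>Only meaningful for strongly connected graphs with finitely many vertices.\<close>

definition graph_diameter :: "('a, 'b) pre_digraph \<Rightarrow> nat" where
  "graph_diameter G = Max ((\<lambda>(u, v). path_dist G u v) ` (verts G \<times> verts G))"

definition mat_diameter :: "real mat \<Rightarrow> nat" where
  "mat_diameter A = graph_diameter (with_proj (mat_graph A))"

definition nnz :: "real mat \<Rightarrow> nat" where
  "nnz A = card (support A)"

definition row_sum :: "real mat \<Rightarrow> nat \<Rightarrow> real" where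
  "row_sum B j = (\<Sum>i<dim_col B. B $$ (j, i))"

definition col_sum :: "real mat \<Rightarrow> nat \<Rightarrow> real" where
  "col_sum B j = (\<Sum>i<dim_row B. B $$ (i, j))"

definition entry_sum :: "real mat \<Rightarrow> real" where
  "entry_sum B = (\<Sum>i<dim_row B. \<Sum>j<dim_col B. B $$ (i, j))"

definition kappa :: "real mat \<Rightarrow> real" where
  "kappa A = entry_sum A / Min ((\<lambda>ij. A $$ ij) ` support A)"

definition diag_exp :: "real vec \<Rightarrow> real mat" where
  "diag_exp u = mat_diag (dim_vec u) (\<lambda>i. exp (u $ i))"

definition scaled :: "real mat \<Rightarrow> real vec \<Rightarrow> real mat" where
  "scaled A u = diag_exp u * A * diag_exp (- u)"

definition exp_balances :: "real \<Rightarrow> real mat \<Rightarrow> real vec \<Rightarrow> bool" where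
  "exp_balances \<epsilon> A u \<longleftrightarrow>
     (\<Sum>j<dim_row A. \<bar>row_sum (scaled A u) j - col_sum (scaled A u) j\<bar>)
       \<le> \<epsilon> * entry_sum (scaled A u)"

definition osborne_update :: "real mat \<Rightarrow> nat \<Rightarrow> real vec \<Rightarrow> real vec" where
  "osborne_update A j u = vec (dim_vec u) (\<lambda>i.
     if i = j then u $ j + 1/2 * ln (col_sum (scaled A u) j) - 1/2 * ln (row_sum (scaled A u) j)
     else u $ i)"

definition osborne_cycle :: "real mat \<Rightarrow> (nat \<Rightarrow> nat) \<Rightarrow> real vec \<Rightarrow> real vec" where
  "osborne_cycle A \<sigma> u = fold (osborne_update A) (map \<sigma> [0..<dim_row A]) u"

primrec osborne :: "real mat \<Rightarrow> (nat \<Rightarrow> nat \<Rightarrow> nat) \<Rightarrow> nat \<Rightarrow> real vec" where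
  "osborne A \<pi> 0 = 0\<^sub>v (dim_row A)"
| "osborne A \<pi> (Suc k) = osborne_cycle A (\<pi> k) (osborne A \<pi> k)"

text \<open>
  Arithmetic operations are counted on a register machine over the exact reals. Each instruction
  performs one operation at unit cost (loading a constant is charged too), so the cost of
  a straight-line program is its length. Only the values of the nonzero entries of the matrix are
  available to a program, in the registers \<open>Entry i j\<close>; which instructions are executed
  depends only on their positions and on the update orderings.
\<close>

datatype reg = Pot nat | Entry nat nat | RowAcc | ColAcc | Tmp

datatype instr =
    Const_Instr reg real
  | Add_Instr reg reg reg
  | Sub_Instr reg reg reg
  | Mul_Instr reg reg reg
  | Div_Instr reg reg reg
  | Sqrt_Instr reg reg
  | Exp_Instr reg reg
  | Ln_Instr reg reg

fun exec_instr :: "instr \<Rightarrow> (reg \<Rightarrow> real) \<Rightarrow> (reg \<Rightarrow> real)" where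
  "exec_instr (Const_Instr x c) s = s(x := c)"
| "exec_instr (Add_Instr x y z) s = s(x := s y + s z)"
| "exec_instr (Sub_Instr x y z) s = s(x := s y - s z)"
| "exec_instr (Mul_Instr x y z) s = s(x := s y * s z)"
| "exec_instr (Div_Instr x y z) s = s(x := s y / s z)"
| "exec_instr (Sqrt_Instr x y) s = s(x := sqrt (s y))"
| "exec_instr (Exp_Instr x y) s = s(x := exp (s y))"
| "exec_instr (Ln_Instr x y) s = s(x := ln (s y))"

definition exec :: "instr list \<Rightarrow> (reg \<Rightarrow> real) \<Rightarrow> (reg \<Rightarrow> real)" where
  "exec = fold exec_instr"

definition arith_ops :: "instr list \<Rightarrow> nat" where
  "arith_ops p = length p"

fun init_mem :: "real mat \<Rightarrow> reg \<Rightarrow> real" where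
  "init_mem A (Entry i j) = (if (i, j) \<in> support A then A $$ (i, j) else 0)"
| "init_mem A _ = 0"

text \<open>Adds \<open>exp (u i - u j) * A i j\<close> to the accumulator \<open>acc\<close>.\<close>

definition acc_entry_prog :: "reg \<Rightarrow> nat \<Rightarrow> nat \<Rightarrow> instr list" where
  "acc_entry_prog acc i j =
     [Sub_Instr Tmp (Pot i) (Pot j), Exp_Instr Tmp Tmp,
      Mul_Instr Tmp Tmp (Entry i j), Add_Instr acc acc Tmp]"

definition row_sum_prog :: "real mat \<Rightarrow> nat \<Rightarrow> instr list" where
  "row_sum_prog A j = Const_Instr RowAcc 0 #
     concat (map (\<lambda>i. acc_entry_prog RowAcc j i) (filter (\<lambda>i. (j, i) \<in> support A) [0..<dim_col A]))"

definition col_sum_prog :: "real mat \<Rightarrow> nat \<Rightarrow> instr list" where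
  "col_sum_prog A j = Const_Instr ColAcc 0 #
     concat (map (\<lambda>i. acc_entry_prog ColAcc i j) (filter (\<lambda>i. (i, j) \<in> support A) [0..<dim_row A]))"

definition update_prog :: "real mat \<Rightarrow> nat \<Rightarrow> instr list" where
  "update_prog A j = row_sum_prog A j @ col_sum_prog A j @
     [Const_Instr Tmp (1/2),
      Ln_Instr ColAcc ColAcc, Mul_Instr ColAcc Tmp ColAcc, Add_Instr (Pot j) (Pot j) ColAcc,
      Ln_Instr RowAcc RowAcc, Mul_Instr RowAcc Tmp RowAcc, Sub_Instr (Pot j) (Pot j) RowAcc]"

definition cycle_prog :: "real mat \<Rightarrow> (nat \<Rightarrow> nat) \<Rightarrow> instr list" where
  "cycle_prog A \<sigma> = concat (map (update_prog A) (map \<sigma> [0..<dim_row A]))"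

definition osborne_prog :: "real mat \<Rightarrow> (nat \<Rightarrow> nat \<Rightarrow> nat) \<Rightarrow> nat \<Rightarrow> instr list" where
  "osborne_prog A \<pi> t = concat (map (\<lambda>k. cycle_prog A (\<pi> k)) [0..<t])"

end

theory Submission
  imports Defs
begin

text \<open>
  Write \<open>S(u)\<close> for the total mass of the scaled matrix, and \<open>X(u)\<close> for its total imbalance. An update
  at a vertex \<open>k\<close> with out-mass \<open>r\<close> and in-mass \<open>c\<close> makes both masses equal to \<open>sqrt (r * c)\<close> and lowers
  \<open>S\<close> by \<open>(sqrt r - sqrt c)\<^sup>2\<close>. The heart of the proof is that one cycle from \<open>u\<close> to \<open>u'\<close>, in any order,
  satisfies \<open>X(u')\<^sup>2 \<le> 6 * S(u) * (S(u) - S(u'))\<close> (\<open>cycle_imbalance\<close>).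

  The reason is that a vertex is balanced right after its own update, and the imbalance it has
  at the end of the cycle was caused by later updates of other vertices. An update at \<open>k\<close> disturbs all
  other vertices together by at most \<open>\<bar>r - c\<bar>\<close> (\<open>imbalance_update\<close>). So \<open>X(u')\<close> is at most the sum of
  \<open>\<bar>r - c\<bar> = \<bar>sqrt r - sqrt c\<bar> * (sqrt r + sqrt c)\<close> over all updates of the cycle. By the Cauchy-Schwarz
  inequality it remains to bound the sum of \<open>r + c\<close>, the masses that the updates encounter, by
  \<open>3 * S(u)\<close>. An edge is encountered twice, and between its two encounters its scaled weight may have
  grown. But if the edges from and to \<open>k\<close> have mass \<open>a\<close> to vertices not yet updated and mass \<open>b\<close> to
  those already updated, then the update leaves mass at most \<open>a + b / 2\<close> on the former, because the new
  masses are geometric means. As \<open>a\<close> sums to \<open>S(u)\<close> over the cycle and every mass left behind is a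
  contribution to a later \<open>b\<close>, the sum of all \<open>b\<close> is at most \<open>2 * S(u)\<close>. A weighted sum of the entries
  that decreases by at least \<open>r + c\<close> in every update expresses this (\<open>pending_mass_update\<close>).

  Consequently a cycle that ends with relative imbalance \<open>x = X(u') / S(u')\<close> decreases \<open>ln S\<close> by at
  least \<open>x\<^sup>2 / 24\<close>. Since \<open>ln S\<close> starts at most \<open>ln \<kappa>\<close> above its infimum, this gives \<open>O(ln \<kappa> / \<epsilon>\<^sup>2)\<close> cycles.
  Moreover \<open>ln S\<close> is convex and the potentials of all iterates spread over an interval of length at
  most \<open>d * ln \<kappa>\<close> (\<open>sublevel_spread\<close>), so the gap of \<open>ln S\<close> to any later iterate is at most
  \<open>2 * d * ln \<kappa> * x\<close> (\<open>ln_total_diff_le\<close>). A large gap thus forces a large imbalance and a large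
  decrease, and this gives \<open>O(d * ln \<kappa> / \<epsilon>)\<close> cycles (\<open>unbalanced_cycles_le\<close>).

  The program computes the same vectors in exact arithmetic, at a cost of at most \<open>17\<close> operations per
  nonzero entry and cycle (\<open>exec_osborne_prog\<close>, \<open>arith_ops_osborne_prog\<close>).
\<close>

section \<open>Osborne updates on a weighted digraph\<close>

locale weighted_digraph =
  fixes V :: "'v set" and a :: "'v \<Rightarrow> 'v \<Rightarrow> real"
  assumes finite_V: "finite V"
    and nonneg: "\<And>i j. i \<in> V \<Longrightarrow> j \<in> V \<Longrightarrow> 0 \<le> a i j"
    and no_loop: "\<And>i. i \<in> V \<Longrightarrow> a i i = 0"
    and out_edge: "\<And>i. i \<in> V \<Longrightarrow> \<exists>j\<in>V. 0 < a i j"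
    and in_edge: "\<And>i. i \<in> V \<Longrightarrow> \<exists>j\<in>V. 0 < a j i"
begin

definition scal :: "('v \<Rightarrow> real) \<Rightarrow> 'v \<Rightarrow> 'v \<Rightarrow> real" where
  "scal u i j = exp (u i - u j) * a i j"

definition out_mass :: "('v \<Rightarrow> real) \<Rightarrow> 'v \<Rightarrow> real" where
  "out_mass u j = (\<Sum>i\<in>V. scal u j i)"

definition in_mass :: "('v \<Rightarrow> real) \<Rightarrow> 'v \<Rightarrow> real" where
  "in_mass u j = (\<Sum>i\<in>V. scal u i j)"

definition total :: "('v \<Rightarrow> real) \<Rightarrow> real" where
  "total u = (\<Sum>i\<in>V. \<Sum>j\<in>V. scal u i j)"

definition imbalance :: "'v set \<Rightarrow> ('v \<Rightarrow> real) \<Rightarrow> real" where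
  "imbalance P u = (\<Sum>j\<in>P. \<bar>out_mass u j - in_mass u j\<bar>)"

definition update :: "'v \<Rightarrow> ('v \<Rightarrow> real) \<Rightarrow> 'v \<Rightarrow> real" where
  "update k u = u(k := u k + 1/2 * ln (in_mass u k) - 1/2 * ln (out_mass u k))"

lemma scal_nonneg: "i \<in> V \<Longrightarrow> j \<in> V \<Longrightarrow> 0 \<le> scal u i j"
  by (simp add: scal_def nonneg)

lemma scal_no_loop [simp]: "i \<in> V \<Longrightarrow> scal u i i = 0"
  by (simp add: scal_def no_loop)

lemma out_mass_pos: "k \<in> V \<Longrightarrow> 0 < out_mass u k"
proof -
  assume k: "k \<in> V"
  then obtain j where "j \<in> V" "0 < a k j" using out_edge by blast
  then show ?thesis
    unfolding out_mass_def using k scal_nonneg finite_V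
    by (intro sum_pos2[of V j]) (auto simp: scal_def[of u k j])
qed

lemma in_mass_pos: "k \<in> V \<Longrightarrow> 0 < in_mass u k"
proof -
  assume k: "k \<in> V"
  then obtain j where "j \<in> V" "0 < a j k" using in_edge by blast
  then show ?thesis
    unfolding in_mass_def using k scal_nonneg finite_V
    by (intro sum_pos2[of V j]) (auto simp: scal_def[of u j k])
qed

lemma total_eq_sum_out: "total u = (\<Sum>j\<in>V. out_mass u j)"
  by (simp add: total_def out_mass_def)

lemma total_eq_sum_in: "total u = (\<Sum>j\<in>V. in_mass u j)"
  unfolding total_def in_mass_def by (rule sum.swap)

lemma total_pos: "V \<noteq> {} \<Longrightarrow> 0 < total u"
  unfolding total_eq_sum_out using finite_V out_mass_pos by (intro sum_pos) auto

lemma scal_le_total: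
  assumes "i \<in> V" "j \<in> V"
  shows "scal u i j \<le> total u"
proof -
  have "scal u i j \<le> out_mass u i"
    unfolding out_mass_def using assms finite_V scal_nonneg by (intro member_le_sum) auto
  also have "\<dots> \<le> total u"
    unfolding total_eq_sum_out using assms finite_V out_mass_pos
    by (intro member_le_sum) (auto simp: less_imp_le)
  finally show ?thesis .
qed

lemma imbalance_le_total: "imbalance V u \<le> 2 * total u"
proof -
  have "imbalance V u \<le> (\<Sum>j\<in>V. out_mass u j + in_mass u j)"
    unfolding imbalance_def
  proof (rule sum_mono)
    fix j assume "j \<in> V"
    then show "\<bar>out_mass u j - in_mass u j\<bar> \<le> out_mass u j + in_mass u j"
      using out_mass_pos[of j u] in_mass_pos[of j u] by linarith
  qed
  then show ?thesis
    by (simp add: sum.distrib flip: total_eq_sum_out total_eq_sum_in)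
qed

text \<open>
  An update at \<open>k\<close> changes only row and column \<open>k\<close>, so each before-and-after comparison below
  reduces to the first sum on the right.
\<close>

lemma double_sum_isolate:
  fixes f :: "'v \<Rightarrow> 'v \<Rightarrow> real"
  assumes "k \<in> V" "f k k = 0"
  shows "(\<Sum>i\<in>V. \<Sum>j\<in>V. f i j)
    = (\<Sum>j\<in>V. f k j + f j k) + (\<Sum>i\<in>V - {k}. \<Sum>j\<in>V - {k}. f i j)"
proof -
  have split: "sum g V = g k + sum g (V - {k})" for g :: "'v \<Rightarrow> real"
    by (rule sum.remove[OF finite_V assms(1)])
  have "(\<Sum>i\<in>V. \<Sum>j\<in>V. f i j)
      = (\<Sum>j\<in>V. f k j) + (\<Sum>i\<in>V - {k}. f i k + (\<Sum>j\<in>V - {k}. f i j))"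
    by (subst split) (simp add: split)
  also have "\<dots> = (\<Sum>j\<in>V. f k j) + (\<Sum>i\<in>V. f i k) + (\<Sum>i\<in>V - {k}. \<Sum>j\<in>V - {k}. f i j)"
    using split[of "\<lambda>i. f i k"] assms(2) by (simp add: sum.distrib)
  finally show ?thesis by (simp add: sum.distrib)
qed

context
  fixes k :: 'v and u :: "'v \<Rightarrow> real"
  assumes k: "k \<in> V"
begin

lemma exp_half_ln_diff:
  "exp (1/2 * ln (in_mass u k) - 1/2 * ln (out_mass u k)) = sqrt (in_mass u k / out_mass u k)"
  using out_mass_pos[OF k, of u] in_mass_pos[OF k, of u]
  by (simp add: exp_diff powr_half_sqrt[symmetric] powr_def real_sqrt_divide)

lemma scal_update_out:
  assumes "j \<noteq> k"
  shows "scal (update k u) k j = sqrt (in_mass u k / out_mass u k) * scal u k j"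
proof -
  have "update k u k - update k u j
      = (1/2 * ln (in_mass u k) - 1/2 * ln (out_mass u k)) + (u k - u j)"
    using assms by (simp add: update_def)
  then show ?thesis
    by (simp only: scal_def exp_add exp_half_ln_diff mult.assoc)
qed

lemma scal_update_in:
  assumes "j \<noteq> k"
  shows "scal (update k u) j k = scal u j k / sqrt (in_mass u k / out_mass u k)"
proof -
  have "update k u j - update k u k
      = (u j - u k) - (1/2 * ln (in_mass u k) - 1/2 * ln (out_mass u k))"
    using assms by (simp add: update_def)
  then have "exp (update k u j - update k u k)
      = exp (u j - u k) / sqrt (in_mass u k / out_mass u k)"
    by (simp only: exp_diff[of "u j - u k"] exp_half_ln_diff)
  then show ?thesis by (simp add: scal_def)
qed

lemma scal_update_other: "i \<noteq> k \<Longrightarrow> j \<noteq> k \<Longrightarrow> scal (update k u) i j = scal u i j"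
  by (simp add: scal_def update_def)

text \<open>
  The potential is shifted by half the logarithm of the ratio of the two masses, so out- and
  in-mass of \<open>k\<close> both become their geometric mean: the update balances \<open>k\<close>.
\<close>

lemma out_mass_update: "out_mass (update k u) k = sqrt (out_mass u k) * sqrt (in_mass u k)"
proof -
  have "out_mass (update k u) k = (\<Sum>j\<in>V. sqrt (in_mass u k / out_mass u k) * scal u k j)"
    unfolding out_mass_def[of "update k u"]
    by (rule sum.cong) (use k scal_update_out in \<open>auto, metis mult_zero_right scal_no_loop\<close>)
  also have "\<dots> = sqrt (in_mass u k / out_mass u k) * out_mass u k"
    by (simp add: out_mass_def sum_distrib_left)
  also have "\<dots> = sqrt (out_mass u k) * sqrt (in_mass u k)"
    using out_mass_pos[OF k, of u] by (simp add: real_sqrt_divide field_simps)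
  finally show ?thesis .
qed

lemma in_mass_update: "in_mass (update k u) k = sqrt (out_mass u k) * sqrt (in_mass u k)"
proof -
  have "in_mass (update k u) k = (\<Sum>j\<in>V. scal u j k / sqrt (in_mass u k / out_mass u k))"
    unfolding in_mass_def[of "update k u"]
    by (rule sum.cong) (use k scal_update_in in \<open>auto, metis div_0 scal_no_loop\<close>)
  also have "\<dots> = in_mass u k / sqrt (in_mass u k / out_mass u k)"
    by (simp add: in_mass_def sum_divide_distrib)
  also have "\<dots> = sqrt (out_mass u k) * sqrt (in_mass u k)"
    using in_mass_pos[OF k, of u] by (simp add: real_sqrt_divide field_simps)
  finally show ?thesis .
qed

lemma total_update:
  "total (update k u) = total u - (sqrt (out_mass u k) - sqrt (in_mass u k))\<^sup>2"
proof -
  have isolate: "total v = out_mass v k + in_mass v k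
      + (\<Sum>i\<in>V - {k}. \<Sum>j\<in>V - {k}. scal v i j)" for v
    unfolding total_def out_mass_def in_mass_def
    using double_sum_isolate[OF k, of "scal v"] k by (simp add: sum.distrib)
  have "(\<Sum>i\<in>V - {k}. \<Sum>j\<in>V - {k}. scal (update k u) i j)
      = (\<Sum>i\<in>V - {k}. \<Sum>j\<in>V - {k}. scal u i j)"
    by (intro sum.cong) (auto simp: scal_update_other)
  then show ?thesis
    using isolate[of u] isolate[of "update k u"] out_mass_pos[OF k, of u] in_mass_pos[OF k, of u]
    by (simp add: out_mass_update in_mass_update power2_diff)
qed

text \<open>
  The out-edges of \<open>k\<close> are scaled by a common factor and its in-edges by the inverse factor. So the
  mass moved on them, which bounds the imbalance newly created at other vertices, is
  \<open>\<bar>sqrt (r * c) - r\<bar> + \<bar>sqrt (r * c) - c\<bar> = \<bar>r - c\<bar>\<close> for the old out-mass \<open>r\<close> and in-mass \<open>c\<close> of \<open>k\<close>.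
  The last term is this quantity in factorised form; its first factor is the one that is squared
  in \<open>total_update\<close>.
\<close>

lemma imbalance_update:
  assumes P: "P \<subseteq> V" "k \<notin> P"
  shows "imbalance (insert k P) (update k u) \<le> imbalance P u
    + \<bar>sqrt (out_mass u k) - sqrt (in_mass u k)\<bar> * (sqrt (out_mass u k) + sqrt (in_mass u k))"
proof -
  define r where "r = out_mass u k"
  define c where "c = in_mass u k"
  define q where "q = sqrt (c / r)"
  have r: "0 < r" and c: "0 < c"
    using out_mass_pos[OF k] in_mass_pos[OF k] by (auto simp: r_def c_def)
  then have q: "0 < q" by (simp add: q_def)
  have finP: "finite P" using P finite_V finite_subset by blast
  have change: "\<bar>out_mass (update k u) j - in_mass (update k u) j\<bar>
      \<le> \<bar>out_mass u j - in_mass u j\<bar> + (\<bar>1/q - 1\<bar> * scal u j k + \<bar>q - 1\<bar> * scal u k j)"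
    if "j \<in> P" for j
  proof -
    have j: "j \<in> V" "j \<noteq> k" using that P by auto
    have "out_mass (update k u) j - out_mass u j = (1/q - 1) * scal u j k"
      unfolding out_mass_def sum.remove[OF finite_V k]
      using j by (simp add: scal_update_in scal_update_other q_def r_def c_def algebra_simps)
    moreover have "in_mass (update k u) j - in_mass u j = (q - 1) * scal u k j"
      unfolding in_mass_def sum.remove[OF finite_V k]
      using j by (simp add: scal_update_out scal_update_other q_def r_def c_def algebra_simps)
    moreover have "\<bar>(1/q - 1) * scal u j k\<bar> = \<bar>1/q - 1\<bar> * scal u j k"
      "\<bar>(q - 1) * scal u k j\<bar> = \<bar>q - 1\<bar> * scal u k j"
      using scal_nonneg[of _ _ u] j k by (simp_all add: abs_mult)
    ultimately show ?thesis by linarith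
  qed
  have "imbalance P (update k u) \<le> imbalance P u
      + (\<bar>1/q - 1\<bar> * (\<Sum>j\<in>P. scal u j k) + \<bar>q - 1\<bar> * (\<Sum>j\<in>P. scal u k j))"
    unfolding imbalance_def sum_distrib_left sum.distrib[symmetric]
    by (rule sum_mono) (rule change)
  moreover have "(\<Sum>j\<in>P. scal u j k) \<le> c" "(\<Sum>j\<in>P. scal u k j) \<le> r"
    unfolding c_def in_mass_def r_def out_mass_def
    using P k finite_V scal_nonneg by (auto intro!: sum_mono2)
  then have "\<bar>1/q - 1\<bar> * (\<Sum>j\<in>P. scal u j k) + \<bar>q - 1\<bar> * (\<Sum>j\<in>P. scal u k j)
      \<le> \<bar>1/q - 1\<bar> * c + \<bar>q - 1\<bar> * r"
    by (intro add_mono mult_left_mono) auto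
  moreover have "\<bar>1/q - 1\<bar> * c = \<bar>sqrt r - sqrt c\<bar> * sqrt c"
  proof -
    have "\<bar>1/q - 1\<bar> * c = \<bar>(1/q - 1) * c\<bar>" using c by (simp add: abs_mult)
    also have "(1/q - 1) * c = (sqrt r - sqrt c) * sqrt c"
      using r c by (simp add: q_def real_sqrt_divide field_simps)
    finally show ?thesis using c by (simp add: abs_mult)
  qed
  moreover have "\<bar>q - 1\<bar> * r = \<bar>sqrt r - sqrt c\<bar> * sqrt r"
  proof -
    have "\<bar>q - 1\<bar> * r = \<bar>(q - 1) * r\<bar>" using r by (simp add: abs_mult)
    also have "(q - 1) * r = - ((sqrt r - sqrt c) * sqrt r)"
      using r c by (simp add: q_def real_sqrt_divide field_simps)
    finally show ?thesis using r by (simp add: abs_mult)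
  qed
  moreover have "imbalance (insert k P) (update k u) = imbalance P (update k u)"
    using finP P by (simp add: imbalance_def out_mass_update in_mass_update)
  ultimately show ?thesis
    by (simp add: r_def c_def algebra_simps)
qed

end

section \<open>Progress of one cycle\<close>

text \<open>
  Here \<open>U\<close> is the set of vertices that the current cycle has not updated yet. The weights are
  chosen such that the mass seen by an update is paid for by the decrease of the weighted sum
  \<open>pending_mass\<close>, although an update may increase the mass on the edges that still await their
  second update.
\<close>

definition pending_weight :: "'v set \<Rightarrow> 'v \<Rightarrow> 'v \<Rightarrow> real" where
  "pending_weight U i j = (if i \<in> U \<and> j \<in> U then 3 else if i \<in> U \<or> j \<in> U then 2 else 0)"

definition pending_mass :: "'v set \<Rightarrow> ('v \<Rightarrow> real) \<Rightarrow> real" where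
  "pending_mass U u = (\<Sum>i\<in>V. \<Sum>j\<in>V. pending_weight U i j * scal u i j)"

text \<open>
  Let \<open>a = a\<^sub>o + a\<^sub>i\<close> be the mass on out- and in-edges between \<open>k\<close> and the other pending vertices, and
  let \<open>q = sqrt (c / r)\<close> be the scaling factor. Before the update the edges at \<open>k\<close> contribute
  \<open>2 * (r + c) + a\<close>, afterwards \<open>2 * (q * a\<^sub>o + a\<^sub>i / q)\<close>. Since \<open>2 * q \<le> 1 + q\<^sup>2\<close>, \<open>a\<^sub>o \<le> r\<close> and
  \<open>q\<^sup>2 * r = c\<close>, the term \<open>2 * q * a\<^sub>o\<close> is at most \<open>a\<^sub>o + c\<close>; symmetrically \<open>2 * a\<^sub>i / q \<le> a\<^sub>i + r\<close>.
\<close>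

lemma pending_mass_update:
  assumes U: "U \<subseteq> V" and kU: "k \<in> U"
  shows "pending_mass (U - {k}) (update k u) + (out_mass u k + in_mass u k) \<le> pending_mass U u"
proof -
  have k: "k \<in> V" using U kU by blast
  define r where "r = out_mass u k"
  define c where "c = in_mass u k"
  define q where "q = sqrt (c / r)"
  define ao where "ao = (\<Sum>j\<in>U. scal u k j)"
  define ai where "ai = (\<Sum>j\<in>U. scal u j k)"
  have r: "0 < r" and c: "0 < c"
    using out_mass_pos[OF k] in_mass_pos[OF k] by (auto simp: r_def c_def)
  then have q: "0 < q" "q\<^sup>2 = c / r" by (simp_all add: q_def)
  have ao: "0 \<le> ao" "ao \<le> r" and ai: "0 \<le> ai" "ai \<le> c"
    unfolding ao_def ai_def r_def c_def out_mass_def in_mass_def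
    using U k finite_V scal_nonneg by (auto intro!: sum_mono2 sum_nonneg)
  define rest where "rest = (\<Sum>i\<in>V - {k}. \<Sum>j\<in>V - {k}. pending_weight U i j * scal u i j)"
  have finU: "finite U" using U finite_V finite_subset by blast
  have before: "pending_mass U u = 2 * (r + c) + (ao + ai) + rest"
  proof -
    have "(\<Sum>j\<in>V. pending_weight U k j * scal u k j + pending_weight U j k * scal u j k)
        = (\<Sum>j\<in>V. 2 * (scal u k j + scal u j k)
            + (if j \<in> U then scal u k j + scal u j k else 0))"
      using kU by (intro sum.cong) (auto simp: pending_weight_def)
    also have "\<dots> = 2 * (r + c) + (ao + ai)"
    proof -
      have "(\<Sum>j\<in>V. if j \<in> U then scal u k j + scal u j k else 0) = ao + ai"
        unfolding ao_def ai_def sum.distrib[symmetric]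
        using U finite_V by (simp add: sum.If_cases Int_absorb1)
      moreover have "(\<Sum>j\<in>V. 2 * (scal u k j + scal u j k)) = 2 * (r + c)"
        by (simp add: r_def c_def out_mass_def in_mass_def sum.distrib flip: sum_distrib_left)
      ultimately show ?thesis by (simp add: sum.distrib)
    qed
    finally show ?thesis
      unfolding pending_mass_def rest_def
      using double_sum_isolate[OF k, of "\<lambda>i j. pending_weight U i j * scal u i j"] k by simp
  qed
  have after: "pending_mass (U - {k}) (update k u) = 2 * (q * ao + ai / q) + rest"
  proof -
    let ?W = "pending_weight (U - {k})" and ?s = "scal (update k u)"
    have "(\<Sum>j\<in>V. ?W k j * ?s k j + ?W j k * ?s j k)
        = (\<Sum>j\<in>V. if j \<in> U then 2 * (q * scal u k j + scal u j k / q) else 0)"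
    proof (rule sum.cong[OF refl])
      fix j assume "j \<in> V"
      then show "?W k j * ?s k j + ?W j k * ?s j k
          = (if j \<in> U then 2 * (q * scal u k j + scal u j k / q) else 0)"
        using k by (cases "j = k")
          (auto simp: pending_weight_def scal_update_out scal_update_in q_def r_def c_def)
    qed
    also have "\<dots> = (\<Sum>j\<in>U. 2 * (q * scal u k j + scal u j k / q))"
      using U finite_V by (simp add: sum.If_cases Int_absorb1)
    also have "\<dots> = 2 * (q * ao + ai / q)"
      by (simp add: ao_def ai_def sum.distrib sum_distrib_left sum_divide_distrib algebra_simps)
    finally have "(\<Sum>j\<in>V. ?W k j * ?s k j + ?W j k * ?s j k) = 2 * (q * ao + ai / q)" .
    moreover have "(\<Sum>i\<in>V - {k}. \<Sum>j\<in>V - {k}. ?W i j * ?s i j) = rest"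
      unfolding rest_def using k
      by (intro sum.cong) (auto simp: pending_weight_def scal_update_other)
    ultimately show ?thesis
      unfolding pending_mass_def
      using double_sum_isolate[OF k, of "\<lambda>i j. ?W i j * ?s i j"] k by simp
  qed
  have "2 * (q * ao) \<le> ao + c"
  proof -
    have "2 * q \<le> 1 + q\<^sup>2" using sum_squares_bound[of q 1] by (simp add: power2_eq_square)
    then have "2 * (q * ao) \<le> (1 + q\<^sup>2) * ao"
      using mult_right_mono[OF _ ao(1)] by fastforce
    moreover have "q\<^sup>2 * ao \<le> q\<^sup>2 * r" using ao by (intro mult_left_mono) auto
    moreover have "q\<^sup>2 * r = c" using q r by simp
    ultimately show ?thesis by (simp add: algebra_simps)
  qed
  moreover have "2 * (ai / q) \<le> ai + r"
  proof -
    have "2 * (1/q) \<le> 1 + (1/q)\<^sup>2" using sum_squares_bound[of "1/q" 1] by (simp add: power2_eq_square)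
    then have "2 * ((1/q) * ai) \<le> (1 + (1/q)\<^sup>2) * ai"
      using mult_right_mono[OF _ ai(1)] by fastforce
    moreover have "(1/q)\<^sup>2 * ai \<le> (1/q)\<^sup>2 * c" using ai by (intro mult_left_mono) auto
    moreover have "(1/q)\<^sup>2 * c = r" using q r c by (simp add: power_divide)
    ultimately show ?thesis by (simp add: algebra_simps)
  qed
  ultimately show ?thesis
    unfolding before after r_def[symmetric] c_def[symmetric] distrib_left by linarith
qed

text \<open>
  The three accounts of one update are combined: by the arithmetic-geometric mean inequality with
  weight \<open>\<theta>\<close>, the imbalance passed on to the updated vertices \<open>P\<close> is paid for partly by the
  decrease of the total mass and partly by the decrease of the pending mass.
\<close>

lemma cycle_potential_step:
  assumes P: "P \<subseteq> V" and k: "k \<in> V - P" and lam: "0 < \<theta>"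
  shows "imbalance (insert k P) (update k u) + \<theta>/2 * total (update k u)
      + 1/\<theta> * pending_mass (V - insert k P) (update k u)
    \<le> imbalance P u + \<theta>/2 * total u + 1/\<theta> * pending_mass (V - P) u"
proof -
  define x where "x = sqrt (out_mass u k)"
  define y where "y = sqrt (in_mass u k)"
  have kV: "k \<in> V" using k by blast
  have sq: "x\<^sup>2 = out_mass u k" "y\<^sup>2 = in_mass u k" and pos: "0 \<le> x" "0 \<le> y"
    using out_mass_pos[OF kV, of u] in_mass_pos[OF kV, of u] by (auto simp: x_def y_def)
  have "V - P - {k} = V - insert k P" by blast
  then have pend: "pending_mass (V - insert k P) (update k u) + (x\<^sup>2 + y\<^sup>2) \<le> pending_mass (V - P) u"
    using pending_mass_update[of "V - P" k u] k by (simp add: sq)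
  have tot: "total (update k u) = total u - (x - y)\<^sup>2"
    using total_update[OF kV, of u] by (simp add: x_def y_def)
  have imb: "imbalance (insert k P) (update k u) \<le> imbalance P u + \<bar>x - y\<bar> * (x + y)"
    using imbalance_update[OF kV P, of u] k by (simp add: x_def y_def)
  have "\<bar>x - y\<bar> * (x + y) \<le> \<theta>/2 * (x - y)\<^sup>2 + 1/\<theta> * (x\<^sup>2 + y\<^sup>2)"
  proof -
    have "2 * \<theta> * (\<bar>x - y\<bar> * (x + y)) \<le> (\<theta> * \<bar>x - y\<bar>)\<^sup>2 + (x + y)\<^sup>2"
      using sum_squares_bound[of "\<theta> * \<bar>x - y\<bar>" "x + y"] by (simp add: algebra_simps)
    also have "\<dots> \<le> \<theta>\<^sup>2 * (x - y)\<^sup>2 + 2 * (x\<^sup>2 + y\<^sup>2)"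
      using sum_squares_bound[of x y] by (simp add: power_mult_distrib power2_sum)
    finally show ?thesis using lam by (simp add: field_simps power2_eq_square)
  qed
  moreover have "1/\<theta> * (pending_mass (V - insert k P) (update k u) + (x\<^sup>2 + y\<^sup>2))
      \<le> 1/\<theta> * pending_mass (V - P) u"
    using pend lam by (intro mult_left_mono) auto
  ultimately show ?thesis
    using imb unfolding tot by (simp add: algebra_simps)
qed

lemma cycle_potential_fold:
  assumes "distinct ks" "set ks \<inter> P = {}" "set ks \<union> P \<subseteq> V" "0 < \<theta>"
  shows "imbalance (set ks \<union> P) (fold update ks u) + \<theta>/2 * total (fold update ks u)
      + 1/\<theta> * pending_mass (V - (set ks \<union> P)) (fold update ks u)
    \<le> imbalance P u + \<theta>/2 * total u + 1/\<theta> * pending_mass (V - P) u"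
  using assms
proof (induction ks arbitrary: P u)
  case Nil
  then show ?case by simp
next
  case (Cons k ks)
  have "set (k # ks) \<union> P = set ks \<union> insert k P" by auto
  then show ?case
    using Cons.IH[of "insert k P" "update k u"] cycle_potential_step[of P k \<theta> u] Cons.prems
    by fastforce
qed

lemma total_fold_update:
  assumes "set ks \<subseteq> V"
  shows "total (fold update ks u) \<le> total u"
  using assms
proof (induction ks arbitrary: u)
  case (Cons k ks)
  then show ?case
    using Cons.IH[of "update k u"] total_update[of k u] by (smt (verit) fold_simps(2)
      list.set_intros(1) set_subset_Cons subset_iff zero_le_power2)
qed simp

text \<open>
  Over a whole cycle the potential starts at \<open>(\<theta> / 2) * S + (3 / \<theta>) * S\<close> and ends at
  \<open>X + (\<theta> / 2) * S'\<close>, where \<open>S\<close> and \<open>S'\<close> are the total masses before and after the cycle and \<open>X\<close> is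
  the final imbalance. The bound follows by choosing \<open>\<theta>\<close>.
\<close>

lemma cycle_imbalance:
  assumes ks: "distinct ks" "set ks = V"
  shows "(imbalance V (fold update ks u))\<^sup>2 \<le> 6 * total u * (total u - total (fold update ks u))"
proof (cases "imbalance V (fold update ks u) = 0")
  case True
  have "0 \<le> total u" unfolding total_def by (intro sum_nonneg scal_nonneg)
  then show ?thesis using True total_fold_update[of ks u] ks by simp
next
  case False
  define X where "X = imbalance V (fold update ks u)"
  have X: "0 < X" using False by (simp add: X_def imbalance_def sum_nonneg order.not_eq_order_implies_strict)
  then have "V \<noteq> {}" by (auto simp: X_def imbalance_def)
  then have S: "0 < total u" by (rule total_pos)
  \<comment> \<open>chosen such that the contribution of the pending mass is half of the imbalance\<close>
  define \<theta> where "\<theta> = 6 * total u / X"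
  have lam: "0 < \<theta>" using X S by (simp add: \<theta>_def)
  have "pending_mass V u = 3 * total u"
    by (simp add: pending_mass_def total_def pending_weight_def sum_distrib_left)
  moreover have "pending_mass {} v = 0" for v
    by (simp add: pending_mass_def pending_weight_def)
  ultimately have "X + \<theta>/2 * total (fold update ks u) \<le> \<theta>/2 * total u + 1/\<theta> * (3 * total u)"
    using cycle_potential_fold[of ks "{}" \<theta> u] ks lam by (simp add: X_def imbalance_def)
  moreover have "1/\<theta> * (3 * total u) = X / 2" using X S by (simp add: \<theta>_def)
  ultimately have "X \<le> \<theta> * (total u - total (fold update ks u))" by (simp add: algebra_simps)
  then have "X * X \<le> \<theta> * (total u - total (fold update ks u)) * X"
    using X by (intro mult_right_mono) auto
  then show ?thesis using X by (simp add: \<theta>_def power2_eq_square flip: X_def)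
qed

section \<open>Suboptimality is bounded by the imbalance\<close>

text \<open>
  \<open>ln (total u)\<close> is convex in \<open>u\<close>, with gradient \<open>(out_mass u i - in_mass u i) / total u\<close>. Convexity
  bounds the difference by the gradient applied to \<open>u - v\<close>. As shifting all potentials by a
  constant changes nothing, \<open>u - v\<close> may be normalised to vanish at one vertex, and is then bounded by
  \<open>2 * R\<close> everywhere.
\<close>

lemma ln_total_diff_le:
  assumes V: "V \<noteq> {}"
    and R: "\<And>i j. i \<in> V \<Longrightarrow> j \<in> V \<Longrightarrow> \<bar>u i - u j\<bar> \<le> R" "\<And>i j. i \<in> V \<Longrightarrow> j \<in> V \<Longrightarrow> \<bar>v i - v j\<bar> \<le> R"
  shows "ln (total u) - ln (total v) \<le> imbalance V u / total u * (2 * R)"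
proof -
  obtain b where b: "b \<in> V" using V by blast
  define w where "w i = (v i - u i) - (v b - u b)" for i
  have w: "\<bar>w i\<bar> \<le> 2 * R" if "i \<in> V" for i
    using R(1)[OF that b] R(2)[OF that b] by (simp add: w_def)
  have S: "0 < total u" "0 < total v" using total_pos[OF V] by auto
  \<comment> \<open>the directional derivative of \<open>ln (total u)\<close> along \<open>w\<close>, up to normalisation the direction
    from \<open>u\<close> to \<open>v\<close>; also the mean of \<open>w i - w j\<close> over the edges weighted by \<open>scal u\<close>\<close>
  define y where "y = (\<Sum>i\<in>V. (out_mass u i - in_mass u i) * w i) / total u"
  have lin: "(\<Sum>i\<in>V. \<Sum>j\<in>V. scal u i j * (w i - w j)) = y * total u"
  proof -
    have y: "y * total u = (\<Sum>i\<in>V. (out_mass u i - in_mass u i) * w i)"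
      using S by (simp add: y_def)
    have "(\<Sum>i\<in>V. \<Sum>j\<in>V. scal u i j * (w i - w j))
        = (\<Sum>i\<in>V. \<Sum>j\<in>V. scal u i j * w i) - (\<Sum>i\<in>V. \<Sum>j\<in>V. scal u i j * w j)"
      by (simp add: right_diff_distrib sum_subtractf)
    also have "(\<Sum>i\<in>V. \<Sum>j\<in>V. scal u i j * w j) = (\<Sum>j\<in>V. \<Sum>i\<in>V. scal u i j * w j)"
      by (rule sum.swap)
    finally show ?thesis
      unfolding y by (simp add: out_mass_def in_mass_def left_diff_distrib sum_subtractf
          sum_distrib_right)
  qed
  \<comment> \<open>Jensen's inequality, from the tangent of the exponential function at \<open>0\<close>\<close>
  have "(\<Sum>i\<in>V. \<Sum>j\<in>V. scal u i j * (1 + ((w i - w j) - y))) \<le> (\<Sum>i\<in>V. \<Sum>j\<in>V. scal v i j * exp (- y))"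
  proof (intro sum_mono)
    fix i j assume ij: "i \<in> V" "j \<in> V"
    have "scal v i j * exp (- y) = scal u i j * exp ((w i - w j) - y)"
      by (simp add: scal_def w_def exp_diff exp_minus field_simps flip: exp_add)
    then show "scal u i j * (1 + ((w i - w j) - y)) \<le> scal v i j * exp (- y)"
      using scal_nonneg[OF ij, of u] exp_ge_add_one_self by (simp add: mult_left_mono)
  qed
  moreover have "(\<Sum>i\<in>V. \<Sum>j\<in>V. scal u i j * (1 + ((w i - w j) - y)))
      = total u + (\<Sum>i\<in>V. \<Sum>j\<in>V. scal u i j * (w i - w j)) - total u * y"
    unfolding total_def
    by (simp add: algebra_simps sum.distrib sum_subtractf sum_distrib_left)
  moreover have "(\<Sum>i\<in>V. \<Sum>j\<in>V. scal v i j * exp (- y)) = total v * exp (- y)"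
    by (simp add: total_def sum_distrib_right)
  ultimately have "total u \<le> total v * exp (- y)"
    unfolding lin by (simp add: mult.commute)
  then have "ln (total u) \<le> ln (total v * exp (- y))" using S by simp
  then have "ln (total u) - ln (total v) \<le> - y" using S by (simp add: ln_mult)
  also have "- y \<le> imbalance V u / total u * (2 * R)"
  proof -
    have "- (\<Sum>i\<in>V. (out_mass u i - in_mass u i) * w i)
        \<le> (\<Sum>i\<in>V. \<bar>out_mass u i - in_mass u i\<bar> * (2 * R))"
      unfolding sum_negf[symmetric]
    proof (rule sum_mono)
      fix i assume "i \<in> V"
      have "- ((out_mass u i - in_mass u i) * w i) \<le> \<bar>out_mass u i - in_mass u i\<bar> * \<bar>w i\<bar>"
        by (metis abs_ge_minus_self abs_mult)
      also have "\<dots> \<le> \<bar>out_mass u i - in_mass u i\<bar> * (2 * R)"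
        using w[OF \<open>i \<in> V\<close>] by (intro mult_left_mono) auto
      finally show "- ((out_mass u i - in_mass u i) * w i) \<le> \<dots>" .
    qed
    then show ?thesis
      using divide_right_mono[OF _ less_imp_le[OF S(1)]]
      by (fastforce simp: y_def imbalance_def sum_distrib_right)
  qed
  finally show ?thesis .
qed

text \<open>
  An out-edge of a vertex of maximal potential is scaled by a factor of at least \<open>1\<close>.
\<close>

lemma min_weight_le_total:
  assumes V: "V \<noteq> {}"
    and mu: "\<And>i j. i \<in> V \<Longrightarrow> j \<in> V \<Longrightarrow> 0 < a i j \<Longrightarrow> \<mu> \<le> a i j"
  shows "\<mu> \<le> total u"
proof -
  obtain i where i: "i \<in> V" and max: "\<And>j. j \<in> V \<Longrightarrow> u j \<le> u i"
    using Max_in[of "u ` V"] Max_ge[of "u ` V"] finite_V V by fastforce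
  obtain j where j: "j \<in> V" "0 < a i j" using out_edge[OF i] by blast
  have "\<mu> \<le> 1 * a i j" using mu i j by simp
  also have "\<dots> \<le> scal u i j"
    unfolding scal_def using max[OF j(1)] j by (intro mult_right_mono) auto
  also have "\<dots> \<le> total u" using i j by (intro scal_le_total)
  finally show ?thesis .
qed

end

section \<open>Counting cycles\<close>

text \<open>
  This turns the conclusion of \<open>cycle_imbalance\<close> into a decrease of the logarithm of the total mass.
  The imbalance is measured relative to the new mass \<open>S'\<close> but the bound involves the old mass \<open>S\<close>,
  so the ratio matters: if at least half of the mass remains, the two agree up to a constant;
  otherwise the logarithm has dropped by a constant anyway.
\<close>

lemma ln_ratio_ge_square:
  fixes S S' X :: real
  assumes S: "0 < S" "0 < S'" and X: "0 \<le> X" "X \<le> 2 * S'" and dec: "X\<^sup>2 \<le> 6 * S * (S - S')"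
  shows "(X / S')\<^sup>2 / 24 \<le> ln S - ln S'"
proof -
  define s where "s = S' / S"
  define x where "x = X / S'"
  have s: "0 < s" and x: "0 \<le> x" "x \<le> 2" using S X by (simp_all add: s_def x_def pos_divide_le_eq)
  have "x\<^sup>2 * s\<^sup>2 \<le> 6 * (1 - s)"
    using dec S by (simp add: x_def s_def power2_eq_square field_simps)
  have "ln s \<le> s - 1" using s by (rule ln_le_minus_one)
  moreover have "ln S - ln S' = - ln s" using S by (simp add: s_def ln_div)
  moreover have "x\<^sup>2 / 24 \<le> 1 - s"
  proof (cases "1/2 \<le> s")
    case True
    then have "(1/2)\<^sup>2 \<le> s\<^sup>2" by (intro power_mono) auto
    then have "x\<^sup>2 * (1/2)\<^sup>2 \<le> x\<^sup>2 * s\<^sup>2" by (intro mult_left_mono) auto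
    then show ?thesis using \<open>x\<^sup>2 * s\<^sup>2 \<le> 6 * (1 - s)\<close> by (simp add: power2_eq_square)
  next
    case False
    have "x\<^sup>2 \<le> 2\<^sup>2" using x by (intro power_mono) auto
    then show ?thesis using False by simp
  qed
  ultimately show ?thesis by (simp add: x_def)
qed

lemma linear_decrease_count:
  fixes e :: "nat \<Rightarrow> real"
  assumes "m \<le> T" and dec: "\<And>k. m \<le> k \<Longrightarrow> k < T \<Longrightarrow> c \<le> e k - e (Suc k)" 
  shows "real (T - m) * c \<le> e m - e T"
  using assms
proof (induction T rule: dec_induct)
  case (step T)
  then have "real (T - m) * c \<le> e m - e T" "c \<le> e T - e (Suc T)" by auto
  then show ?case using step(1) by (simp add: Suc_diff_le algebra_simps)
qed simp

text \<open>
  A discrete version of \<open>e' = - e\<^sup>2\<close>: the reciprocal of \<open>e\<close> grows at least linearly.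
\<close>

lemma quadratic_decrease_count:
  fixes e :: "nat \<Rightarrow> real"
  assumes L: "1 \<le> L" and le: "\<And>k. k \<le> m \<Longrightarrow> 0 < e k \<and> e k \<le> L"
    and dec: "\<And>k. k < m \<Longrightarrow> (e (Suc k) / L)\<^sup>2 / 24 \<le> e k - e (Suc k)"
  shows "real m \<le> 48 * L\<^sup>2 / e m"
proof -
  have step: "1 / (48 * L\<^sup>2) \<le> 1 / e (Suc k) - 1 / e k" if k: "k < m" for k
  proof -
    define y where "y = e (Suc k) / (24 * L\<^sup>2)"
    have pos: "0 < e (Suc k)" "0 < e k" "e (Suc k) \<le> L" using le[of k] le[of "Suc k"] k by auto
    have "L \<le> L\<^sup>2" using L by (simp add: power2_eq_square)
    then have y: "0 < y" "y \<le> 1" using pos L by (auto simp: y_def)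
    have "e (Suc k) * (1 + y) \<le> e k"
      using dec[OF k] by (simp add: y_def power2_eq_square field_simps)
    then have "1 / e k \<le> 1 / (e (Suc k) * (1 + y))"
      using pos y by (intro divide_left_mono) auto
    also have "\<dots> \<le> (1 - y / 2) / e (Suc k)"
    proof -
      have "1 \<le> (1 - y / 2) * (1 + y)"
        using mult_nonneg_nonneg[of y "1 - y"] y by (simp add: algebra_simps)
      then have "1 / (1 + y) \<le> 1 - y / 2" using y by (simp add: field_simps)
      then have "1 / (1 + y) / e (Suc k) \<le> (1 - y / 2) / e (Suc k)"
        using pos by (intro divide_right_mono) auto
      then show ?thesis by (simp add: mult.commute)
    qed
    also have "\<dots> = 1 / e (Suc k) - 1 / (48 * L\<^sup>2)"
      using pos L by (simp add: y_def field_simps)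
    finally show ?thesis by simp
  qed
  have "real (m - 0) * (1 / (48 * L\<^sup>2)) \<le> - (1 / e 0) - - (1 / e m)"
    using step by (intro linear_decrease_count[of 0 m _ "\<lambda>k. - (1 / e k)"]) auto
  moreover have "0 < 1 / e 0" using le[of 0] by simp
  ultimately have "real m * (1 / (48 * L\<^sup>2)) \<le> 1 / e m" unfolding minus_nat.diff_0 by linarith
  then show ?thesis using L le[of m] by (simp add: field_simps)
qed

text \<open>
  In the application \<open>p k\<close> is the logarithm of the total mass after \<open>k\<close> cycles and \<open>x k\<close> the relative
  imbalance. The first bound holds because every unbalanced cycle decreases \<open>p\<close> by at least
  \<open>\<epsilon>\<^sup>2 / 24\<close>. For the second, let \<open>e k = p k - p T\<close>, so that \<open>x k \<ge> e k / L\<close>. As long as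
  \<open>e k > \<epsilon> * L\<close>, the decrease of \<open>e\<close> is quadratic in \<open>e\<close>, which takes \<open>O(L / \<epsilon>)\<close> cycles; from then on
  cycles with decrease \<open>\<epsilon>\<^sup>2 / 24\<close> use up the remaining \<open>\<epsilon> * L\<close>, again \<open>O(L / \<epsilon>)\<close> cycles. Comparing
  with the final iterate \<open>T\<close> instead of a minimiser avoids the question whether one exists.
\<close>

lemma unbalanced_cycles_le:
  fixes p x :: "nat \<Rightarrow> real"
  assumes eps: "0 < \<epsilon>" and big: "\<And>k. k \<le> T \<Longrightarrow> \<epsilon> < x k"
    and drop: "\<And>k. (x (Suc k))\<^sup>2 / 24 \<le> p k - p (Suc k)"
    and gap: "\<And>k l. p k - p l \<le> x k * L"
    and total_drop: "p 0 - p T \<le> l" and L: "1 \<le> L" "l \<le> L"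
  shows "real T \<le> 24 * l / \<epsilon>\<^sup>2" "real T \<le> 72 * L / \<epsilon> + 1"
proof -
  have eps_drop: "\<epsilon>\<^sup>2 / 24 \<le> p k - p (Suc k)" if "k < T" for k
  proof -
    have "\<epsilon>\<^sup>2 \<le> (x (Suc k))\<^sup>2" using big[of "Suc k"] eps that by (intro power_mono) auto
    then show ?thesis using drop[of k] by linarith
  qed
  have "real (T - 0) * (\<epsilon>\<^sup>2 / 24) \<le> p 0 - p T"
    using eps_drop by (intro linear_decrease_count) auto
  then show "real T \<le> 24 * l / \<epsilon>\<^sup>2" using total_drop eps by (simp add: field_simps)

  define e where "e k = p k - p T" for k
  define m where "m = (LEAST m. e m \<le> \<epsilon> * L)"
  have "e T \<le> \<epsilon> * L" using eps L by (simp add: e_def)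
  then have m: "m \<le> T" "e m \<le> \<epsilon> * L" unfolding m_def by (auto intro: Least_le LeastI)
  have before: "\<epsilon> * L < e k" if "k < m" for k
    using not_less_Least[of k "\<lambda>m. e m \<le> \<epsilon> * L"] that by (simp add: m_def)
  have "real (T - m) * (\<epsilon>\<^sup>2 / 24) \<le> p m - p T"
    using eps_drop m by (intro linear_decrease_count) auto
  then have "real (T - m) * \<epsilon>\<^sup>2 \<le> 24 * (\<epsilon> * L)" using m by (simp add: e_def)
  then have late: "real (T - m) \<le> 24 * L / \<epsilon>" using eps by (simp add: field_simps power2_eq_square)
  have early: "real m \<le> 48 * L / \<epsilon> + 1"
  proof (cases m)
    case 0
    then show ?thesis using eps L by simp
  next
    case (Suc m')
    have mono: "p (Suc k) \<le> p k" for k using drop[of k] zero_le_power2[of "x (Suc k)"] by linarith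
    then have "p k \<le> p 0" for k by (induction k) (auto intro: order_trans)
    then have "e k \<le> L" for k using total_drop L unfolding e_def by (meson diff_right_mono order_trans)
    moreover have pos: "0 < e k" if "k < m" for k
      using before[OF that] mult_pos_pos[OF eps, of L] L by linarith
    moreover have "(e (Suc k) / L)\<^sup>2 / 24 \<le> e k - e (Suc k)" if "k < m'" for k
    proof -
      have "e (Suc k) / L \<le> x (Suc k)" using gap[of "Suc k" T] L by (simp add: e_def field_simps)
      then have "(e (Suc k) / L)\<^sup>2 \<le> (x (Suc k))\<^sup>2"
        using pos[of "Suc k"] that Suc L by (intro power_mono) auto
      then show ?thesis using drop[of k] by (simp add: e_def)
    qed
    ultimately have "real m' \<le> 48 * L\<^sup>2 / e m'"
      using L Suc by (intro quadratic_decrease_count) auto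
    also have "\<dots> \<le> 48 * L\<^sup>2 / (\<epsilon> * L)"
      using before[of m'] Suc eps L by (intro divide_left_mono) (auto intro!: mult_pos_pos simp: pos)
    also have "\<dots> = 48 * L / \<epsilon>" using eps L by (simp add: power2_eq_square)
    finally show ?thesis using Suc by simp
  qed
  have "real T = real (T - m) + real m" using m by simp
  then show "real T \<le> 72 * L / \<epsilon> + 1" using early late
    unfolding times_divide_eq_right[symmetric] by linarith
qed

section \<open>Balanceable matrices\<close>

lemma pcas_last: "pcas i p j \<Longrightarrow> p \<noteq> [] \<Longrightarrow> snd (last p) = j"
  by (induction p arbitrary: i) auto

locale balanceable_matrix =
  fixes n :: nat and A :: "real mat"
  assumes two_le_n: "2 \<le> n"
    and carrier: "A \<in> carrier_mat n n"
    and entry_nonneg: "i < n \<Longrightarrow> j < n \<Longrightarrow> 0 \<le> A $$ (i, j)"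
    and diag_zero: "i < n \<Longrightarrow> A $$ (i, i) = 0"
    and balanceable: "balanceable A"
begin

lemma dims [simp]: "dim_row A = n" "dim_col A = n"
  using carrier by auto

lemma support_iff: "(i, j) \<in> support A \<longleftrightarrow> i < n \<and> j < n \<and> 0 < A $$ (i, j)"
  using entry_nonneg[of i j] by (auto simp: support_def)

lemma finite_support: "finite (support A)"
  by (rule finite_subset[of _ "{..<n} \<times> {..<n}"]) (auto simp: support_def)

abbreviation G :: "(nat, nat \<times> nat) pre_digraph" where
  "G \<equiv> with_proj (mat_graph A)"

lemma G_simps: "verts G = {..<n}" "arcs G = support A"
  by (simp_all add: mat_graph_def)

lemma wf_G: "wf_digraph G"
  by unfold_locales (auto simp: mat_graph_def support_def)

lemma short_walk:
  assumes "i < n" "j < n"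
  shows "\<exists>p. pcas i p j \<and> set p \<subseteq> support A \<and> length p \<le> mat_diameter A"
proof -
  interpret wf_digraph G by (rule wf_G)
  have "i \<rightarrow>\<^sup>*\<^bsub>G\<^esub> j"
    using balanceable assms by (auto simp: balanceable_def strongly_connected_def mat_graph_def)
  then obtain p where "apath i p j" by (auto simp: reachable_apath)
  then have "\<exists>k p. apath i p j \<and> length p = k" by blast
  then have "\<exists>p. apath i p j \<and> length p = path_dist G i j"
    unfolding path_dist_def by (rule LeastI_ex)
  then obtain q where q: "apath i q j" "length q = path_dist G i j" by blast
  have "path_dist G i j \<le> mat_diameter A"
    unfolding mat_diameter_def graph_diameter_def G_simps
    using assms by (intro Max_ge) force+
  moreover have "pcas i q j" "set q \<subseteq> support A"
    using q(1) unfolding apath_def awalk_def G_simps cas_with_proj_eq by auto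
  ultimately show ?thesis using q(2) by metis
qed

lemma ex_out_edge:
  assumes "i < n"
  shows "\<exists>j<n. (i, j) \<in> support A"
proof -
  define j where "j = (if i = 0 then 1 else 0 :: nat)"
  have "j < n" "j \<noteq> i" using two_le_n by (auto simp: j_def)
  then obtain p where "pcas i p j" "set p \<subseteq> support A" using short_walk[OF assms] by blast
  then show ?thesis using \<open>j \<noteq> i\<close> by (cases p) (auto simp: support_def)
qed

lemma ex_in_edge:
  assumes "i < n"
  shows "\<exists>j<n. (j, i) \<in> support A"
proof -
  define j where "j = (if i = 0 then 1 else 0 :: nat)"
  have "j < n" "j \<noteq> i" using two_le_n by (auto simp: j_def)
  then obtain p where p: "pcas j p i" "set p \<subseteq> support A" using short_walk[OF _ assms] by blast
  then have "p \<noteq> []" using \<open>j \<noteq> i\<close> by auto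
  then have "last p \<in> support A" "snd (last p) = i" using p pcas_last by auto
  then show ?thesis by (metis dims(1) prod.collapse support_iff)
qed

lemma one_le_diameter: "1 \<le> mat_diameter A"
proof -
  obtain p where "pcas 0 p (Suc 0)" "length p \<le> mat_diameter A"
    using short_walk[of 0 "Suc 0"] two_le_n by auto
  then show ?thesis by (cases p) auto
qed

sublocale weighted_digraph "{..<n}" "\<lambda>i j. A $$ (i, j)"
proof
  fix i assume "i \<in> {..<n}"
  then show "\<exists>j\<in>{..<n}. 0 < A $$ (i, j)" "\<exists>j\<in>{..<n}. 0 < A $$ (j, i)"
    using ex_out_edge[of i] ex_in_edge[of i] by (auto simp: support_iff)
qed (auto simp: entry_nonneg diag_zero)

lemma vertices_nonempty: "{..<n} \<noteq> {}"
  using two_le_n by (auto simp: lessThan_empty_iff)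

lemma scaled_carrier: "scaled A (vec n u) \<in> carrier_mat n n"
  unfolding scaled_def diag_exp_def using carrier by (auto intro!: mult_carrier_mat)

lemma scaled_entry:
  assumes "i < n" "j < n"
  shows "scaled A (vec n u) $$ (i, j) = scal u i j"
proof -
  have "scaled A (vec n u) = mat_diag n (\<lambda>i. exp (vec n u $ i)) * A
      * mat_diag n (\<lambda>i. exp ((- vec n u) $ i))"
    by (simp add: scaled_def diag_exp_def)
  also have "\<dots> = Matrix.mat n n (\<lambda>(i, j). exp (vec n u $ i) * A $$ (i, j) * exp ((- vec n u) $ j))"
    by (subst mat_diag_mult_left[OF carrier], subst mat_diag_mult_right[of _ n n]) auto
  finally show ?thesis using assms by (simp add: scal_def exp_diff exp_minus field_simps)
qed

lemma scaled_dims [simp]: "dim_row (scaled A (vec n u)) = n" "dim_col (scaled A (vec n u)) = n"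
  using scaled_carrier[of u] by auto

lemma row_sum_scaled: "j < n \<Longrightarrow> row_sum (scaled A (vec n u)) j = out_mass u j"
  by (simp add: row_sum_def out_mass_def scaled_entry)

lemma col_sum_scaled: "j < n \<Longrightarrow> col_sum (scaled A (vec n u)) j = in_mass u j"
  by (simp add: col_sum_def in_mass_def scaled_entry)

lemma entry_sum_scaled: "entry_sum (scaled A (vec n u)) = total u"
  by (simp add: entry_sum_def total_def scaled_entry)

lemma exp_balances_iff:
  "exp_balances \<epsilon> A (vec n u) \<longleftrightarrow> imbalance {..<n} u / total u \<le> \<epsilon>"
  using total_pos[OF vertices_nonempty, of u]
  by (simp add: exp_balances_def entry_sum_scaled row_sum_scaled col_sum_scaled imbalance_def
      pos_divide_le_eq)

lemma osborne_update_vec: "j < n \<Longrightarrow> osborne_update A j (vec n u) = vec n (update j u)"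
  by (rule eq_vecI)
    (auto simp: osborne_update_def update_def row_sum_scaled col_sum_scaled)

lemma fold_osborne_update_vec:
  "set ks \<subseteq> {..<n} \<Longrightarrow> fold (osborne_update A) ks (vec n u) = vec n (fold update ks u)"
  by (induction ks arbitrary: u) (auto simp: osborne_update_vec)

primrec iterate :: "(nat \<Rightarrow> nat \<Rightarrow> nat) \<Rightarrow> nat \<Rightarrow> nat \<Rightarrow> real" where
  "iterate \<pi> 0 = (\<lambda>_. 0)"
| "iterate \<pi> (Suc k) = fold update (map (\<pi> k) [0..<n]) (iterate \<pi> k)"

lemma ordering_list:
  assumes "\<sigma> permutes {..<n}"
  shows "distinct (map \<sigma> [0..<n])" "set (map \<sigma> [0..<n]) = {..<n}"
  using permutes_inj_on[OF assms] permutes_image[OF assms]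
  by (auto simp: distinct_map atLeast0LessThan)

lemma osborne_eq_iterate:
  assumes "\<And>k. \<pi> k permutes {..<n}"
  shows "osborne A \<pi> k = vec n (iterate \<pi> k)"
proof (induction k)
  case 0
  show ?case by (rule eq_vecI) auto
next
  case (Suc k)
  have "set (map (\<pi> k) [0..<n]) \<subseteq> {..<n}" using ordering_list[OF assms[of k]] by simp
  then show ?case by (simp only: osborne.simps osborne_cycle_def dims Suc fold_osborne_update_vec
        iterate.simps)
qed

section \<open>Convergence\<close>

definition min_entry :: real where
  "min_entry = Min ((\<lambda>ij. A $$ ij) ` support A)"

lemma total_zero: "total (\<lambda>_. 0) = entry_sum A"
  by (simp add: total_def entry_sum_def scal_def)

lemma min_entry_le: "i < n \<Longrightarrow> j < n \<Longrightarrow> 0 < A $$ (i, j) \<Longrightarrow> min_entry \<le> A $$ (i, j)"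
  unfolding min_entry_def using finite_support by (intro Min_le) (auto simp: support_iff image_iff)

lemma min_entry_pos: "0 < min_entry"
proof -
  have "support A \<noteq> {}" using ex_out_edge[of 0] two_le_n by auto
  then have "min_entry \<in> (\<lambda>ij. A $$ ij) ` support A"
    unfolding min_entry_def using finite_support by (intro Min_in) auto
  then show ?thesis by (auto simp: support_iff)
qed

lemma kappa_eq: "kappa A = total (\<lambda>_. 0) / min_entry"
  by (simp add: kappa_def min_entry_def total_zero)

text \<open>
  Each of the \<open>n \<ge> 2\<close> vertices has an out-edge. A lower bound on \<open>kappa\<close> away from \<open>1\<close> is what lets
  the constant absorb the additive constants in the number of cycles.
\<close>

lemma two_le_kappa: "2 \<le> kappa A"
proof -
  have "min_entry \<le> out_mass (\<lambda>_. 0) i" if i: "i < n" for i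
  proof -
    obtain j where j: "j < n" "(i, j) \<in> support A" using ex_out_edge[OF i] by blast
    then have "min_entry \<le> scal (\<lambda>_. 0) i j"
      using min_entry_le i by (simp add: scal_def support_iff)
    also have "\<dots> \<le> out_mass (\<lambda>_. 0) i"
      unfolding out_mass_def using i j scal_nonneg by (intro member_le_sum) auto
    finally show ?thesis .
  qed
  then have "(\<Sum>i<n. min_entry) \<le> total (\<lambda>_. 0)"
    unfolding total_eq_sum_out by (intro sum_mono) auto
  then have "real n * min_entry \<le> total (\<lambda>_. 0)" by simp
  moreover have "2 * min_entry \<le> real n * min_entry"
    using two_le_n min_entry_pos by (intro mult_right_mono) auto
  ultimately have "2 * min_entry \<le> total (\<lambda>_. 0)" by linarith
  then show ?thesis using min_entry_pos by (simp add: kappa_eq pos_le_divide_eq)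
qed

lemma ln_kappa_ge: "1/2 \<le> ln (kappa A)"
proof -
  have "exp (1/2 :: real) \<le> 2"
  proof -
    have "(1/2::real) \<le> 1/2" by simp
    then have "exp (1/2 :: real) \<le> 1 + 1/2 + (1/2)\<^sup>2" by (intro exp_bound) auto
    then show ?thesis by (simp add: power2_eq_square)
  qed
  then have "exp (1/2) \<le> kappa A" using two_le_kappa by linarith
  then show ?thesis using two_le_kappa by (subst ln_ge_iff) auto
qed

lemma total_iterate_le:
  assumes "\<And>k. \<pi> k permutes {..<n}"
  shows "total (iterate \<pi> k) \<le> total (\<lambda>_. 0)"
proof (induction k)
  case (Suc k)
  then show ?case
    using total_fold_update[of "map (\<pi> k) [0..<n]" "iterate \<pi> k"] ordering_list[OF assms[of k]]
    by simp
qed simp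

text \<open>
  While the total mass does not exceed its initial value, no scaled entry does either, which bounds
  the potential difference along an edge by \<open>ln (kappa A)\<close>; shortest walks extend the bound to all
  pairs.
\<close>

lemma sublevel_spread:
  assumes u: "total u \<le> total (\<lambda>_. 0)" and ij: "i < n" "j < n"
  shows "u i - u j \<le> real (mat_diameter A) * ln (kappa A)"
proof -
  have edge: "u i - u j \<le> ln (kappa A)" if "(i, j) \<in> support A" for i j
  proof -
    have ij: "i < n" "j < n" "0 < A $$ (i, j)" using that by (auto simp: support_iff)
    have "exp (u i - u j) * min_entry \<le> scal u i j"
      using min_entry_le[OF ij] by (simp add: scal_def)
    also have "\<dots> \<le> total (\<lambda>_. 0)" using scal_le_total[of i j u] ij u by simp
    finally have "exp (u i - u j) \<le> kappa A"
      using min_entry_pos by (simp add: kappa_eq pos_le_divide_eq)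
    then show ?thesis using two_le_kappa by (subst ln_ge_iff) auto
  qed
  have walk: "u i - u j \<le> real (length p) * ln (kappa A)"
    if "pcas i p j" "set p \<subseteq> support A" for i p j
    using that
  proof (induction p arbitrary: i)
    case (Cons e p)
    then have "u (snd e) - u j \<le> real (length p) * ln (kappa A)" "u i - u (snd e) \<le> ln (kappa A)"
      using edge[of "fst e" "snd e"] by auto
    then show ?case by (simp add: distrib_right)
  qed simp
  obtain p where p: "pcas i p j" "set p \<subseteq> support A" "length p \<le> mat_diameter A"
    using short_walk[OF ij] by blast
  have "real (length p) * ln (kappa A) \<le> real (mat_diameter A) * ln (kappa A)"
    using p(3) ln_kappa_ge by (intro mult_right_mono) auto
  then show ?thesis using walk[OF p(1,2)] by linarith
qed

lemma ex_balanced_iterate: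
  assumes perm: "\<And>k. \<pi> k permutes {..<n}" and eps: "0 < \<epsilon>"
  shows "\<exists>t. real t \<le> 160 * (ln (kappa A) / \<epsilon>) * min (1 / \<epsilon>) (real (mat_diameter A))
    \<and> exp_balances \<epsilon> A (osborne A \<pi> t)"
proof -
  define x where "x k = imbalance {..<n} (iterate \<pi> k) / total (iterate \<pi> k)" for k
  define p where "p k = ln (total (iterate \<pi> k))" for k
  define d where "d = real (mat_diameter A)"
  define l where "l = ln (kappa A)"
  have d: "1 \<le> d" using one_le_diameter by (simp add: d_def)
  have l: "1/2 \<le> l" using ln_kappa_ge by (simp add: l_def)
  have balanced_iff: "exp_balances \<epsilon> A (osborne A \<pi> k) \<longleftrightarrow> x k \<le> \<epsilon>" for k
    unfolding osborne_eq_iterate[OF perm] exp_balances_iff x_def ..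
  have S: "0 < total (iterate \<pi> k)" for k by (rule total_pos[OF vertices_nonempty])
  have drop: "(x (Suc k))\<^sup>2 / 24 \<le> p k - p (Suc k)" for k
    unfolding x_def p_def
  proof (rule ln_ratio_ge_square[OF S S])
    show "0 \<le> imbalance {..<n} (iterate \<pi> (Suc k))"
      by (simp add: imbalance_def sum_nonneg)
    show "imbalance {..<n} (iterate \<pi> (Suc k)) \<le> 2 * total (iterate \<pi> (Suc k))"
      by (rule imbalance_le_total)
    show "(imbalance {..<n} (iterate \<pi> (Suc k)))\<^sup>2
        \<le> 6 * total (iterate \<pi> k) * (total (iterate \<pi> k) - total (iterate \<pi> (Suc k)))"
      unfolding iterate.simps by (rule cycle_imbalance[OF ordering_list[OF perm]])
  qed
  have spread_le: "iterate \<pi> k i - iterate \<pi> k j \<le> d * l" if "i < n" "j < n" for k i j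
    unfolding d_def l_def by (rule sublevel_spread[OF total_iterate_le[OF perm] that])
  have spread: "\<bar>iterate \<pi> k i - iterate \<pi> k j\<bar> \<le> d * l" if "i \<in> {..<n}" "j \<in> {..<n}" for k i j
    using spread_le[of i j k] spread_le[of j i k] that by (simp add: abs_le_iff)
  have gap: "p k - p k' \<le> x k * (2 * (d * l))" for k k'
    unfolding p_def x_def by (rule ln_total_diff_le[OF vertices_nonempty spread spread])
  have total_drop: "p 0 - p k \<le> l" for k
  proof -
    have "min_entry \<le> total (iterate \<pi> k)"
      by (rule min_weight_le_total[OF vertices_nonempty]) (auto intro: min_entry_le)
    then have "ln min_entry \<le> p k" using min_entry_pos by (simp add: p_def)
    moreover have "l = p 0 - ln min_entry"
      using S[of 0] min_entry_pos by (simp add: l_def p_def kappa_eq ln_div)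
    ultimately show ?thesis by linarith
  qed
  have L: "1 \<le> 2 * (d * l)" "l \<le> 2 * (d * l)"
    using mult_mono[OF d l] mult_right_mono[OF d, of l] d l by auto
  define Q where "Q = l / \<epsilon> * min (1 / \<epsilon>) d"
  have Q: "0 \<le> Q" using d l eps by (simp add: Q_def)
  have "\<exists>t. real t \<le> 160 * Q \<and> x t \<le> \<epsilon>"
  proof (cases "x 0 \<le> \<epsilon>")
    case True
    then show ?thesis using Q by (intro exI[of _ 0]) simp
  next
    case False
    have "x 0 \<le> 2"
      using imbalance_le_total[of "iterate \<pi> 0"] S[of 0] by (simp only: x_def pos_divide_le_eq)
    \<comment> \<open>with \<open>\<epsilon>\<close> bounded, \<open>Q\<close> is at least \<open>1/8\<close>, which absorbs the additive constants below\<close>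
    then have eps2: "\<epsilon> < 2" using False by linarith
    have unbalanced: "real T \<le> 24 * l / \<epsilon>\<^sup>2" "real T \<le> 72 * (2 * (d * l)) / \<epsilon> + 1"
      if "\<And>k. k \<le> T \<Longrightarrow> \<epsilon> < x k" for T
      by (rule unbalanced_cycles_le[OF eps that drop gap total_drop L], assumption)+
    have "\<exists>t. x t \<le> \<epsilon>"
    proof (rule ccontr)
      assume "\<nexists>t. x t \<le> \<epsilon>"
      then have "real T \<le> 24 * l / \<epsilon>\<^sup>2" for T using unbalanced(1)[of T] by (auto simp: not_le)
      then show False using reals_Archimedean2[of "24 * l / \<epsilon>\<^sup>2"] by (meson not_le)
    qed
    define t where "t = (LEAST t. x t \<le> \<epsilon>)"
    have t: "x t \<le> \<epsilon>" using \<open>\<exists>t. x t \<le> \<epsilon>\<close> unfolding t_def by (rule LeastI_ex)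
    have "\<epsilon> < x k" if "k < t" for k
      using not_less_Least[of k "\<lambda>t. x t \<le> \<epsilon>"] that by (simp add: t_def)
    moreover have "0 < t" using t False by (cases t) auto
    ultimately have T: "real (t - 1) \<le> 24 * l / \<epsilon>\<^sup>2" "real (t - 1) \<le> 72 * (2 * (d * l)) / \<epsilon> + 1"
      using unbalanced[of "t - 1"] by auto
    have "real (t - 1) \<le> 144 * Q + 1"
    proof (cases "1 / \<epsilon> \<le> d")
      case True
      then have "Q = l / \<epsilon>\<^sup>2" by (simp add: Q_def power2_eq_square)
      then show ?thesis using T(1) Q by simp
    next
      case False
      then have "Q = d * l / \<epsilon>" by (simp add: Q_def)
      then show ?thesis using T(2) by simp
    qed
    moreover have "1/8 \<le> Q"
    proof -
      have "1/2 \<le> 1 / \<epsilon>" using eps eps2 by (simp add: field_simps)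
      then have "1/4 \<le> l / \<epsilon>" using mult_mono[of "1/2" l "1/2" "1/\<epsilon>"] l by simp
      moreover have "1/2 \<le> min (1 / \<epsilon>) d" using \<open>1/2 \<le> 1 / \<epsilon>\<close> d by simp
      ultimately show ?thesis
        using mult_mono[of "1/4" "l / \<epsilon>" "1/2" "min (1 / \<epsilon>) d"] l eps
        unfolding Q_def by linarith
    qed
    moreover have "real t = real (t - 1) + 1" using \<open>0 < t\<close> by simp
    ultimately have "real t \<le> 160 * Q" by linarith
    then show ?thesis using t by blast
  qed
  then show ?thesis by (auto simp: balanced_iff Q_def d_def l_def mult.assoc)
qed

end

section \<open>The straight-line program\<close>

lemma exec_Nil: "exec [] s = s"
  by (simp add: exec_def)

lemma exec_Cons: "exec (c # p) s = exec p (exec_instr c s)"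
  by (simp add: exec_def)

lemma exec_append: "exec (p @ q) s = exec q (exec p s)"
  by (simp add: exec_def)

lemma exec_acc_entries:
  fixes f g :: "nat \<Rightarrow> nat"
  assumes acc: "acc \<in> {RowAcc, ColAcc}"
  defines "prog \<equiv> \<lambda>xs. concat (map (\<lambda>x. acc_entry_prog acc (f x) (g x)) xs)"
  shows "exec (prog xs) s acc
      = s acc + (\<Sum>x\<leftarrow>xs. exp (s (Pot (f x)) - s (Pot (g x))) * s (Entry (f x) (g x)))"
    and "r \<notin> {acc, Tmp} \<Longrightarrow> exec (prog xs) s r = s r"
proof -
  have "exec (prog xs) s acc
        = s acc + (\<Sum>x\<leftarrow>xs. exp (s (Pot (f x)) - s (Pot (g x))) * s (Entry (f x) (g x)))
      \<and> (\<forall>r. r \<notin> {acc, Tmp} \<longrightarrow> exec (prog xs) s r = s r)"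
  proof (induction xs arbitrary: s)
    case Nil
    show ?case by (simp add: prog_def exec_Nil)
  next
    case (Cons x xs)
    have "exec (prog (x # xs)) s = exec (prog xs) (exec (acc_entry_prog acc (f x) (g x)) s)"
      by (simp add: prog_def exec_append)
    moreover have "exec (acc_entry_prog acc (f x) (g x)) s acc
        = s acc + exp (s (Pot (f x)) - s (Pot (g x))) * s (Entry (f x) (g x))"
      "\<And>r. r \<notin> {acc, Tmp} \<Longrightarrow> exec (acc_entry_prog acc (f x) (g x)) s r = s r"
      using acc by (auto simp: acc_entry_prog_def exec_Cons exec_Nil)
    ultimately show ?case using Cons.IH acc by auto
  qed
  then show "exec (prog xs) s acc
      = s acc + (\<Sum>x\<leftarrow>xs. exp (s (Pot (f x)) - s (Pot (g x))) * s (Entry (f x) (g x)))"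
    and "r \<notin> {acc, Tmp} \<Longrightarrow> exec (prog xs) s r = s r"
    by blast+
qed

lemma sum_list_filter_upt:
  fixes h :: "nat \<Rightarrow> real"
  assumes "\<And>i. i < n \<Longrightarrow> \<not> P i \<Longrightarrow> h i = 0"
  shows "(\<Sum>i\<leftarrow>filter P [0..<n]. h i) = (\<Sum>i<n. h i)"
proof -
  have "(\<Sum>i\<leftarrow>filter P [0..<n]. h i) = (\<Sum>i\<in>set (filter P [0..<n]). h i)"
    by (rule sum_list_distinct_conv_sum_set) simp
  also have "\<dots> = (\<Sum>i<n. h i)"
    using assms by (intro sum.mono_neutral_left) auto
  finally show ?thesis .
qed

context balanceable_matrix
begin

definition represents :: "(reg \<Rightarrow> real) \<Rightarrow> (nat \<Rightarrow> real) \<Rightarrow> bool" where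
  "represents s u \<longleftrightarrow> (\<forall>i<n. s (Pot i) = u i) \<and> (\<forall>i<n. \<forall>j<n. s (Entry i j) = A $$ (i, j))"

lemma represents_init: "represents (init_mem A) (\<lambda>_. 0)"
  by (auto simp: represents_def support_def)

lemma exec_row_sum:
  assumes s: "represents s u" and j: "j < n"
  shows "exec (row_sum_prog A j) s RowAcc = out_mass u j"
    and "r \<notin> {RowAcc, Tmp} \<Longrightarrow> exec (row_sum_prog A j) s r = s r"
proof -
  let ?xs = "filter (\<lambda>i. (j, i) \<in> support A) [0..<n]"
  have prog: "exec (row_sum_prog A j) s
      = exec (concat (map (\<lambda>i. acc_entry_prog RowAcc j i) ?xs)) (s(RowAcc := 0))"
    by (simp add: row_sum_prog_def exec_Cons)
  have "exec (row_sum_prog A j) s RowAcc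
      = (\<Sum>i\<leftarrow>?xs. exp (s (Pot j) - s (Pot i)) * s (Entry j i))"
    unfolding prog using exec_acc_entries(1)[of RowAcc "\<lambda>_. j" "\<lambda>i. i"] by simp
  also have "\<dots> = (\<Sum>i<n. exp (s (Pot j) - s (Pot i)) * s (Entry j i))"
    using s j by (intro sum_list_filter_upt) (auto simp: represents_def support_def)
  also have "\<dots> = out_mass u j"
    unfolding out_mass_def using s j by (intro sum.cong) (auto simp: represents_def scal_def)
  finally show "exec (row_sum_prog A j) s RowAcc = out_mass u j" .
  show "exec (row_sum_prog A j) s r = s r" if "r \<notin> {RowAcc, Tmp}"
    unfolding prog using exec_acc_entries(2)[of RowAcc r "\<lambda>_. j" "\<lambda>i. i"] that by simp
qed

lemma exec_col_sum:
  assumes s: "represents s u" and j: "j < n"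
  shows "exec (col_sum_prog A j) s ColAcc = in_mass u j"
    and "r \<notin> {ColAcc, Tmp} \<Longrightarrow> exec (col_sum_prog A j) s r = s r"
proof -
  let ?xs = "filter (\<lambda>i. (i, j) \<in> support A) [0..<n]"
  have prog: "exec (col_sum_prog A j) s
      = exec (concat (map (\<lambda>i. acc_entry_prog ColAcc i j) ?xs)) (s(ColAcc := 0))"
    by (simp add: col_sum_prog_def exec_Cons)
  have "exec (col_sum_prog A j) s ColAcc
      = (\<Sum>i\<leftarrow>?xs. exp (s (Pot i) - s (Pot j)) * s (Entry i j))"
    unfolding prog using exec_acc_entries(1)[of ColAcc "\<lambda>i. i" "\<lambda>_. j"] by simp
  also have "\<dots> = (\<Sum>i<n. exp (s (Pot i) - s (Pot j)) * s (Entry i j))"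
    using s j by (intro sum_list_filter_upt) (auto simp: represents_def support_def)
  also have "\<dots> = in_mass u j"
    unfolding in_mass_def using s j by (intro sum.cong) (auto simp: represents_def scal_def)
  finally show "exec (col_sum_prog A j) s ColAcc = in_mass u j" .
  show "exec (col_sum_prog A j) s r = s r" if "r \<notin> {ColAcc, Tmp}"
    unfolding prog using exec_acc_entries(2)[of ColAcc r "\<lambda>i. i" "\<lambda>_. j"] that by simp
qed

lemma represents_update:
  assumes s: "represents s u" and j: "j < n"
  shows "represents (exec (update_prog A j) s) (update j u)"
proof -
  define s1 where "s1 = exec (row_sum_prog A j) s"
  define s2 where "s2 = exec (col_sum_prog A j) s1"
  have s1: "s1 RowAcc = out_mass u j" "\<And>r. r \<notin> {RowAcc, Tmp} \<Longrightarrow> s1 r = s r"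
    using exec_row_sum[OF s j] by (auto simp: s1_def)
  then have "represents s1 u" using s by (simp add: represents_def)
  from exec_col_sum[OF this j]
  have s2: "s2 ColAcc = in_mass u j" "\<And>r. r \<notin> {ColAcc, Tmp} \<Longrightarrow> s2 r = s1 r"
    by (auto simp: s2_def)
  have "exec (update_prog A j) s = exec [Const_Instr Tmp (1/2),
      Ln_Instr ColAcc ColAcc, Mul_Instr ColAcc Tmp ColAcc, Add_Instr (Pot j) (Pot j) ColAcc,
      Ln_Instr RowAcc RowAcc, Mul_Instr RowAcc Tmp RowAcc, Sub_Instr (Pot j) (Pot j) RowAcc] s2"
    by (simp add: update_prog_def exec_append s1_def s2_def)
  then show ?thesis
    using s j by (auto simp: represents_def exec_Cons exec_Nil s1 s2 update_def)
qed

lemma represents_updates: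
  "represents s u \<Longrightarrow> set ks \<subseteq> {..<n} \<Longrightarrow>
    represents (exec (concat (map (update_prog A) ks)) s) (fold update ks u)"
  by (induction ks arbitrary: s u) (auto simp: exec_Nil exec_append represents_update)

lemma represents_iterate:
  assumes perm: "\<And>k. \<pi> k permutes {..<n}"
  shows "represents (exec (osborne_prog A \<pi> t) (init_mem A)) (iterate \<pi> t)"
proof (induction t)
  case 0
  show ?case using represents_init by (simp add: osborne_prog_def exec_Nil)
next
  case (Suc t)
  have "osborne_prog A \<pi> (Suc t)
      = osborne_prog A \<pi> t @ concat (map (update_prog A) (map (\<pi> t) [0..<n]))"
    by (simp add: osborne_prog_def cycle_prog_def)
  then show ?case
    using represents_updates[OF Suc, of "map (\<pi> t) [0..<n]"] ordering_list[OF perm[of t]]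
    by (simp add: exec_append)
qed

lemma exec_osborne_prog:
  assumes "\<And>k. \<pi> k permutes {..<n}" "j < n"
  shows "exec (osborne_prog A \<pi> t) (init_mem A) (Pot j) = osborne A \<pi> t $ j"
  using represents_iterate[of \<pi> t] assms by (simp add: represents_def osborne_eq_iterate)

lemma length_update_prog:
  "length (update_prog A j)
    = 9 + 4 * card {i. (j, i) \<in> support A} + 4 * card {i. (i, j) \<in> support A}"
proof -
  have filt: "length (filter P [0..<n]) = card {i. P i}" if "\<And>i. P i \<Longrightarrow> i < n" for P
  proof -
    have "{i. P i} = set (filter P [0..<n])" using that by auto
    then show ?thesis by (simp only: distinct_card distinct_filter distinct_upt)
  qed
  have len: "length (concat (map (\<lambda>x. acc_entry_prog acc (f x) (g x)) xs)) = 4 * length xs"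
    for acc f g and xs :: "nat list"
    by (induction xs) (auto simp: acc_entry_prog_def)
  show ?thesis
    using len[of RowAcc "\<lambda>_. j" "\<lambda>i. i"] len[of ColAcc "\<lambda>i. i" "\<lambda>_. j"]
      filt[of "\<lambda>i. (j, i) \<in> support A"] filt[of "\<lambda>i. (i, j) \<in> support A"]
    by (simp add: update_prog_def row_sum_prog_def col_sum_prog_def support_iff)
qed

lemma nnz_eq_sum_out: "nnz A = (\<Sum>j<n. card {i. (j, i) \<in> support A})"
proof -
  have "support A = (SIGMA j:{..<n}. {i. (j, i) \<in> support A})" by (auto simp: support_iff)
  then have "nnz A = card (SIGMA j:{..<n}. {i. (j, i) \<in> support A})" by (simp add: nnz_def)
  also have "\<dots> = (\<Sum>j<n. card {i. (j, i) \<in> support A})"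
    by (rule card_SigmaI) (auto simp: support_iff)
  finally show ?thesis .
qed

lemma nnz_eq_sum_in: "nnz A = (\<Sum>j<n. card {i. (i, j) \<in> support A})"
proof -
  have "prod.swap ` support A = (SIGMA j:{..<n}. {i. (i, j) \<in> support A})"
    by (force simp: support_iff)
  then have "nnz A = card (SIGMA j:{..<n}. {i. (i, j) \<in> support A})"
    unfolding nnz_def by (metis card_image inj_swap inj_on_subset subset_UNIV)
  also have "\<dots> = (\<Sum>j<n. card {i. (i, j) \<in> support A})"
    by (rule card_SigmaI) (auto simp: support_iff)
  finally show ?thesis .
qed

lemma n_le_nnz: "n \<le> nnz A"
proof -
  have "(\<Sum>j<n. 1) \<le> (\<Sum>j<n. card {i. (j, i) \<in> support A})"
  proof (rule sum_mono)
    fix j assume "j \<in> {..<n}"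
    then obtain i where "(j, i) \<in> support A" using ex_out_edge[of j] by auto
    moreover have "finite {i. (j, i) \<in> support A}"
      by (rule finite_subset[of _ "{..<n}"]) (auto simp: support_iff)
    ultimately show "1 \<le> card {i. (j, i) \<in> support A}"
      by (metis One_nat_def Suc_leI card_gt_0_iff empty_iff mem_Collect_eq)
  qed
  then show ?thesis by (simp add: nnz_eq_sum_out)
qed

text \<open>
  A cycle inspects every nonzero entry twice, with \<open>4\<close> operations each time, and spends \<open>9\<close> further
  operations on each vertex; these are dominated by the entries because every vertex has an out-edge.
\<close>

lemma length_cycle_prog:
  assumes "\<sigma> permutes {..<n}"
  shows "length (cycle_prog A \<sigma>) \<le> 17 * nnz A"
proof -
  have "length (cycle_prog A \<sigma>) = (\<Sum>j\<leftarrow>map \<sigma> [0..<n]. length (update_prog A j))"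
    by (simp add: cycle_prog_def length_concat comp_def)
  also have "\<dots> = (\<Sum>j\<in>set (map \<sigma> [0..<n]). length (update_prog A j))"
    by (rule sum_list_distinct_conv_sum_set[OF ordering_list(1)[OF assms]])
  also have "\<dots> = (\<Sum>j<n. length (update_prog A j))"
    by (simp only: ordering_list(2)[OF assms])
  also have "\<dots> = 9 * n + 4 * nnz A + 4 * nnz A"
  proof -
    have "4 * nnz A = (\<Sum>j<n. 4 * card {i. (j, i) \<in> support A})"
      "4 * nnz A = (\<Sum>j<n. 4 * card {i. (i, j) \<in> support A})"
      by (subst nnz_eq_sum_out nnz_eq_sum_in, simp only: sum_distrib_left)+
    then show ?thesis by (simp add: length_update_prog sum.distrib)
  qed
  also have "\<dots> \<le> 17 * nnz A" using n_le_nnz by simp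
  finally show ?thesis .
qed

lemma arith_ops_osborne_prog:
  assumes "\<And>k. \<pi> k permutes {..<n}"
  shows "arith_ops (osborne_prog A \<pi> t) \<le> 17 * nnz A * t"
proof (induction t)
  case (Suc t)
  have "arith_ops (osborne_prog A \<pi> (Suc t))
      = arith_ops (osborne_prog A \<pi> t) + length (cycle_prog A (\<pi> t))"
    by (simp add: osborne_prog_def arith_ops_def)
  then show ?case using Suc length_cycle_prog[OF assms[of t]] by simp
qed (simp add: osborne_prog_def arith_ops_def)

end

theorem corollary1:
  shows "\<exists>C C' :: real. C > 0 \<and> C' > 0 \<and>
    (\<forall>(n :: nat) (A :: real mat) (\<epsilon> :: real) (\<pi> :: nat \<Rightarrow> nat \<Rightarrow> nat).
       n \<ge> 2 \<longrightarrow> A \<in> carrier_mat n n \<longrightarrow>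
       (\<forall>i<n. \<forall>j<n. A $$ (i, j) \<ge> 0) \<longrightarrow> (\<forall>i<n. A $$ (i, i) = 0) \<longrightarrow>
       balanceable A \<longrightarrow> \<epsilon> > 0 \<longrightarrow> (\<forall>k. \<pi> k permutes {..<n}) \<longrightarrow>
       (\<exists>t :: nat.
          real t \<le> C * (ln (kappa A) / \<epsilon>) * min (1 / \<epsilon>) (real (mat_diameter A)) \<and>
          exp_balances \<epsilon> A (osborne A \<pi> t) \<and>
          (\<forall>j<n. exec (osborne_prog A \<pi> t) (init_mem A) (Pot j) = osborne A \<pi> t $ j) \<and>
          real (arith_ops (osborne_prog A \<pi> t))
            \<le> C' * (real (nnz A) * ln (kappa A) / \<epsilon>) * min (1 / \<epsilon>) (real (mat_diameter A))))"
proof (rule exI[of _ 160], rule exI[of _ "17 * 160"], intro conjI allI impI)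
  fix n :: nat and A :: "real mat" and \<epsilon> :: real and \<pi> :: "nat \<Rightarrow> nat \<Rightarrow> nat"
  assume "2 \<le> n" "A \<in> carrier_mat n n" "\<forall>i<n. \<forall>j<n. 0 \<le> A $$ (i, j)" "\<forall>i<n. A $$ (i, i) = 0"
    "balanceable A" and eps: "0 < \<epsilon>" and "\<forall>k. \<pi> k permutes {..<n}"
  then have perm: "\<pi> k permutes {..<n}" for k by blast
  have matrix: "balanceable_matrix n A"
  proof
    show "2 \<le> n" "A \<in> carrier_mat n n" "balanceable A" by fact+
    show "0 \<le> A $$ (i, j)" if "i < n" "j < n" for i j
      using \<open>\<forall>i<n. \<forall>j<n. 0 \<le> A $$ (i, j)\<close> that by blast
    show "A $$ (i, i) = 0" if "i < n" for i
      using \<open>\<forall>i<n. A $$ (i, i) = 0\<close> that by blast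
  qed
  let ?Q = "(ln (kappa A) / \<epsilon>) * min (1 / \<epsilon>) (real (mat_diameter A))"
  obtain t where t: "real t \<le> 160 * (ln (kappa A) / \<epsilon>) * min (1 / \<epsilon>) (real (mat_diameter A))"
    "exp_balances \<epsilon> A (osborne A \<pi> t)"
    using balanceable_matrix.ex_balanced_iterate[OF matrix, where \<pi> = \<pi>, OF perm eps] by blast
  have "exec (osborne_prog A \<pi> t) (init_mem A) (Pot j) = osborne A \<pi> t $ j" if "j < n" for j
    by (rule balanceable_matrix.exec_osborne_prog[OF matrix perm that])
  moreover have "real (arith_ops (osborne_prog A \<pi> t))
      \<le> 17 * 160 * (real (nnz A) * ln (kappa A) / \<epsilon>) * min (1 / \<epsilon>) (real (mat_diameter A))"
  proof -
    have "real (arith_ops (osborne_prog A \<pi> t)) \<le> real (17 * nnz A * t)"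
      using balanceable_matrix.arith_ops_osborne_prog[OF matrix, where \<pi> = \<pi>, OF perm] of_nat_mono by blast
    also have "\<dots> = 17 * real (nnz A) * real t" by simp
    also have "\<dots> \<le> 17 * real (nnz A) * (160 * ?Q)"
      using t(1) by (intro mult_left_mono) (auto simp: mult.assoc)
    finally show ?thesis by (simp add: algebra_simps)
  qed
  ultimately show "\<exists>t :: nat.
      real t \<le> 160 * (ln (kappa A) / \<epsilon>) * min (1 / \<epsilon>) (real (mat_diameter A)) \<and>
      exp_balances \<epsilon> A (osborne A \<pi> t) \<and>
      (\<forall>j<n. exec (osborne_prog A \<pi> t) (init_mem A) (Pot j) = osborne A \<pi> t $ j) \<and>
      real (arith_ops (osborne_prog A \<pi> t))
        \<le> 17 * 160 * (real (nnz A) * ln (kappa A) / \<epsilon>) * min (1 / \<epsilon>) (real (mat_diameter A))"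
    using t by blast
qed auto

end
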